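(* Let $(M,d_M)$ be a metric space, let $L,\epsilon\ge 0$, let $(X,f)$ be an $M$-metric field with $(L,\epsilon)$-connectivity, and let $\delta>0$. Let $V\subset X$ be a finite subspace such that for every $x\in X$ there exists $v\in V$ with $d_X(x,v)<\delta$ and $d_M(f(x),f(v))\le\delta$. Let $G=(V,E)$ be the simple graph with node set $V$ in which distinct $v,w\in V$ are joined by an edge if and only if $d_X(v,w)\le 3\delta$, and let $g:=f|_V:V\to M$. Then there is a $$\big((5L+1)\delta+3\epsilon,\ \delta,\ (5L+1)\delta+3\epsilon\big)\text{-correspondence}$$ between $(R_f,D_f)$ and $(R_g,D_g)$.
   Context: $M$-metric field: a pair $(X,f)$ with $(X,d_X)$ a compact, connected, locally path connected metric space and $f:X\to M$ continuous. Reeb radius of a field: $\rho_f(x,y):=\inf_\gamma\sup_{t} d_M(f(x),f(\gamma(t)))$, over all continuous paths $\gamma:[0,1]\to X$ from $x$ to $y$. $(L,\epsilon)$-connectivity: $\rho_f(x,y)\le L\,d_X(x,y)+2\epsilon$ for all $x,y\in X$. Reeb radius of a graph: for a finite simple graph $G=(V,E)$ and $g:V\to M$, $\rho_g(v,w)$ is the minimum, over all edge paths $v=v_0,\dots,v_n=w$ ($n\ge0$, $[v_i,v_{i+1}]\in E$ for all $i$), of $\max_{0\le i\le n} d_M(g(v),g(v_i))$. Reeb spaces: $R_f=X/\!\sim$, where $x\sim x'$ iff $x,x'$ lie in the same connected component of a level set of $f$ (equivalently $\rho_f(x,x')=0$); similarly $R_g=V/\!\sim$, where $v\sim w$ iff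 $\rho_g(v,w)=0$. $\rho$ depends only on classes, and the Reeb spaces carry the metrics $d_f([x],[y]):=2\max(\rho_f(x,y),\rho_f(y,x))$ and $d_g([v],[w]):=2\max(\rho_g(v,w),\rho_g(w,v))$. Filtration decorations: $D_f([x]):=(X,\rho_f(x,\cdot))$, i.e. the metric space $(X,d_X)$ with the real-valued function $\rho_f(x,\cdot)$; $D_g([v]):=(V,\rho_g(v,\cdot))$, where $V$ has the metric restricted from $d_X$. A correspondence between sets is a subset of their product whose two coordinate projections are surjective. For metric spaces $A,B$ with real-valued functions $p,q$, an $(s,t)$-correspondence between $(A,p)$ and $(B,q)$ is a correspondence $\mathcal{R}$ such that for all $(a,b),(a',b')\in\mathcal{R}$: $|d_A(a,a')-d_B(b,b')|\le 2s$ and $|p(a)-q(b)|\le t$. For metric spaces $A,B$ with functions $D_A,D_B$ assigning to each point a metric space with a real-valued function, a correspondence $\mathcal{S}$ between $A$ and $B$ is an $(r,s,t)$-correspondence between $(A,D_A)$ and $(B,D_B)$ if for all $(a,b),(a',b')\in\mathcal{S}$: $|d_A(a,a')-d_B(b,b')|\le 2r$ and there is an $(s,t)$-correspondence between $D_A(a)$ and $D_B(b)$. *)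

theory Defs
  imports "HOL-Analysis.Analysis"
begin

section \<open>Metric fields and their Reeb spaces\<close>

text \<open>The space is a subset \<^term>\<open>X\<close> of a metric type with the restricted metric; the target metric
  space is the whole type \<^typ>\<open>'b\<close>. Values of \<^term>\<open>f\<close> outside \<^term>\<open>X\<close> are never used.\<close>

definition metric_field :: "'a::metric_space set \<Rightarrow> ('a \<Rightarrow> 'b::metric_space) \<Rightarrow> bool" where
  "metric_field X f \<longleftrightarrow>
     compact X \<and> connected X \<and> locally path_connected X \<and> continuous_on X f"

definition paths_between :: "'a::topological_space set \<Rightarrow> 'a \<Rightarrow> 'a \<Rightarrow> (real \<Rightarrow> 'a) set" where
  "paths_between X x y =
     {\<gamma>. path \<gamma> \<and> path_image \<gamma> \<subseteq> X \<and> pathstart \<gamma> = x \<and> pathfinish \<gamma> = y}"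

text \<open>On a metric field, the infimum and the suprema below are taken over nonempty sets of reals
  bounded from the required side, so they have their usual meaning.\<close>

definition reeb_radius ::
    "'a::metric_space set \<Rightarrow> ('a \<Rightarrow> 'b::metric_space) \<Rightarrow> 'a \<Rightarrow> 'a \<Rightarrow> real" where
  "reeb_radius X f x y =
     (INF \<gamma>\<in>paths_between X x y. SUP t\<in>{0..1}. dist (f x) (f (\<gamma> t)))"

definition connectivity ::
    "real \<Rightarrow> real \<Rightarrow> 'a::metric_space set \<Rightarrow> ('a \<Rightarrow> 'b::metric_space) \<Rightarrow> bool" where
  "connectivity L \<epsilon> X f \<longleftrightarrow>
     (\<forall>x\<in>X. \<forall>y\<in>X. reeb_radius X f x y \<le> L * dist x y + 2 * \<epsilon>)"

definition reeb_rel :: "'a::topological_space set \<Rightarrow> ('a \<Rightarrow> 'b) \<Rightarrow> ('a \<times> 'a) set" where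
  "reeb_rel X f =
     {(x, x'). x \<in> X \<and> x' \<in> X \<and> connected_component {z \<in> X. f z = f x} x x'}"

definition reeb_space :: "'a::topological_space set \<Rightarrow> ('a \<Rightarrow> 'b) \<Rightarrow> 'a set set" where
  "reeb_space X f = X // reeb_rel X f"

text \<open>Functions on equivalence classes are evaluated at an arbitrary representative; independence
  of the choice is proved below (\<open>reeb_dist_class\<close>, \<open>reeb_decoration_class\<close> and their graph
  versions).\<close>

definition rep :: "'a set \<Rightarrow> 'a" where
  "rep P = (SOME x. x \<in> P)"

definition reeb_dist ::
    "'a::metric_space set \<Rightarrow> ('a \<Rightarrow> 'b::metric_space) \<Rightarrow> 'a set \<Rightarrow> 'a set \<Rightarrow> real" where
  "reeb_dist X f P Q =
     2 * max (reeb_radius X f (rep P) (rep Q)) (reeb_radius X f (rep Q) (rep P))"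

section \<open>Reeb spaces of finite graphs\<close>

text \<open>A simple graph has a vertex set \<^term>\<open>V\<close> and a set \<^term>\<open>E\<close> of two-element subsets of
  \<^term>\<open>V\<close>. A walk is the nonempty list of its vertices; a singleton list is the walk of length 0.\<close>

definition edge_paths :: "'a set \<Rightarrow> 'a set set \<Rightarrow> 'a \<Rightarrow> 'a \<Rightarrow> 'a list set" where
  "edge_paths V E v w =
     {vs. vs \<noteq> [] \<and> set vs \<subseteq> V \<and> hd vs = v \<and> last vs = w \<and>
          successively (\<lambda>u u'. {u, u'} \<in> E) vs}"

text \<open>There may be infinitely many walks, but for finite \<^term>\<open>V\<close> only finitely many values; the
  minimum is meaningful as soon as some walk joins the two vertices.\<close>

definition graph_reeb_radius ::
    "'a set \<Rightarrow> 'a set set \<Rightarrow> ('a \<Rightarrow> 'b::metric_space) \<Rightarrow> 'a \<Rightarrow> 'a \<Rightarrow> real" where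
  "graph_reeb_radius V E g v w =
     Min ((\<lambda>vs. Max ((\<lambda>u. dist (g v) (g u)) ` set vs)) ` edge_paths V E v w)"

definition graph_reeb_rel ::
    "'a set \<Rightarrow> 'a set set \<Rightarrow> ('a \<Rightarrow> 'b::metric_space) \<Rightarrow> ('a \<times> 'a) set" where
  "graph_reeb_rel V E g = {(v, w). v \<in> V \<and> w \<in> V \<and> graph_reeb_radius V E g v w = 0}"

definition graph_reeb_space ::
    "'a set \<Rightarrow> 'a set set \<Rightarrow> ('a \<Rightarrow> 'b::metric_space) \<Rightarrow> 'a set set" where
  "graph_reeb_space V E g = V // graph_reeb_rel V E g"

definition graph_reeb_dist ::
    "'a set \<Rightarrow> 'a set set \<Rightarrow> ('a \<Rightarrow> 'b::metric_space) \<Rightarrow> 'a set \<Rightarrow> 'a set \<Rightarrow> real" where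
  "graph_reeb_dist V E g P Q =
     2 * max (graph_reeb_radius V E g (rep P) (rep Q)) (graph_reeb_radius V E g (rep Q) (rep P))"

section \<open>Decorations and correspondences\<close>

text \<open>A metric space is given by carrier and distance function, as in the locale
  \<^locale>\<open>Metric_space\<close>; a filtered one carries a real-valued function in addition.\<close>

type_synonym 'a filtered_space = "'a set \<times> ('a \<Rightarrow> 'a \<Rightarrow> real) \<times> ('a \<Rightarrow> real)"

definition reeb_decoration ::
    "'a::metric_space set \<Rightarrow> ('a \<Rightarrow> 'b::metric_space) \<Rightarrow> 'a set \<Rightarrow> 'a filtered_space" where
  "reeb_decoration X f P = (X, dist, reeb_radius X f (rep P))"

definition graph_reeb_decoration ::
    "'a::metric_space set \<Rightarrow> 'a set set \<Rightarrow> ('a \<Rightarrow> 'b::metric_space) \<Rightarrow> 'a set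
      \<Rightarrow> 'a filtered_space" where
  "graph_reeb_decoration V E g P = (V, dist, graph_reeb_radius V E g (rep P))"

definition correspondence :: "'a set \<Rightarrow> 'b set \<Rightarrow> ('a \<times> 'b) set \<Rightarrow> bool" where
  "correspondence A B R \<longleftrightarrow> R \<subseteq> A \<times> B \<and> fst ` R = A \<and> snd ` R = B"

fun filtered_correspondence ::
    "real \<Rightarrow> real \<Rightarrow> 'a filtered_space \<Rightarrow> 'b filtered_space \<Rightarrow> ('a \<times> 'b) set \<Rightarrow> bool" where
  "filtered_correspondence s t (A, dA, p) (B, dB, q) R \<longleftrightarrow>
     correspondence A B R \<and>
     (\<forall>(a, b)\<in>R. \<forall>(a', b')\<in>R. \<bar>dA a a' - dB b b'\<bar> \<le> 2 * s \<and> \<bar>p a - q b\<bar> \<le> t)"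

definition decorated_correspondence ::
    "real \<Rightarrow> real \<Rightarrow> real
      \<Rightarrow> 'a set \<Rightarrow> ('a \<Rightarrow> 'a \<Rightarrow> real) \<Rightarrow> ('a \<Rightarrow> 'c filtered_space)
      \<Rightarrow> 'b set \<Rightarrow> ('b \<Rightarrow> 'b \<Rightarrow> real) \<Rightarrow> ('b \<Rightarrow> 'd filtered_space)
      \<Rightarrow> ('a \<times> 'b) set \<Rightarrow> bool" where
  "decorated_correspondence r s t A dA DA B dB DB S \<longleftrightarrow>
     correspondence A B S \<and>
     (\<forall>(a, b)\<in>S. \<forall>(a', b')\<in>S.
        \<bar>dA a a' - dB b b'\<bar> \<le> 2 * r \<and>
        (\<exists>R. filtered_correspondence s t (DA a) (DB b) R))"

section \<open>Independence of representatives: fields\<close>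

lemma equiv_reeb_rel: "equiv X (reeb_rel X f)"
proof (rule equivI)
  show "reeb_rel X f \<subseteq> X \<times> X" by (auto simp: reeb_rel_def)
  show "refl_on X (reeb_rel X f)"
    by (auto simp: refl_on_def reeb_rel_def)
  have eq: "f x' = f x" if "connected_component {z \<in> X. f z = f x} x x'" for x x'
    using connected_component_in[OF that] by simp
  show "sym (reeb_rel X f)"
  proof (rule symI)
    fix x y assume xy: "(x, y) \<in> reeb_rel X f"
    then have "f y = f x" by (auto simp: reeb_rel_def dest: eq)
    then show "(y, x) \<in> reeb_rel X f"
      using xy by (simp add: reeb_rel_def connected_component_sym)
  qed
  show "trans (reeb_rel X f)"
  proof (rule transI)
    fix x y z assume xy: "(x, y) \<in> reeb_rel X f" and yz: "(y, z) \<in> reeb_rel X f"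
    then have "f y = f x" by (auto simp: reeb_rel_def dest: eq)
    then show "(x, z) \<in> reeb_rel X f"
      using xy yz connected_component_trans by (fastforce simp: reeb_rel_def)
  qed
qed

lemma rep_equiv_class:
  assumes "equiv A r" "x \<in> A"
  shows "(x, rep (r `` {x})) \<in> r"
proof -
  have "x \<in> r `` {x}" using assms by (rule equiv_class_self)
  then have "rep (r `` {x}) \<in> r `` {x}" unfolding rep_def by (rule someI)
  then show ?thesis by simp
qed

lemma connected_nested_compact:
  fixes K :: "nat \<Rightarrow> 'a::metric_space set"
  assumes comp: "\<And>n. compact (K n)" and conn: "\<And>n. connected (K n)"
    and dec: "\<And>m n. m \<le> n \<Longrightarrow> K n \<subseteq> K m"
  shows "connected (\<Inter> (range K))"
proof (rule ccontr)
  let ?I = "\<Inter> (range K)"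
  assume "\<not> connected ?I"
  then have "\<exists>A B. closed A \<and> closed B \<and> ?I \<subseteq> A \<union> B \<and> A \<inter> B \<inter> ?I = {} \<and>
      A \<inter> ?I \<noteq> {} \<and> B \<inter> ?I \<noteq> {}"
    by (simp only: connected_closed not_not)
  then obtain A B where AB: "closed A" "closed B" "?I \<subseteq> A \<union> B" "A \<inter> B \<inter> ?I = {}"
      "A \<inter> ?I \<noteq> {}" "B \<inter> ?I \<noteq> {}"
    by (elim exE conjE)
  have "closed ?I" using compact_imp_closed[OF comp] by (intro closed_INT) simp
  then have "closed (A \<inter> ?I)" "closed (B \<inter> ?I)"
    using AB(1,2) by (simp_all only: closed_Int)
  moreover have "(A \<inter> ?I) \<inter> (B \<inter> ?I) = {}" using AB(4) by blast
  ultimately obtain U W where UW: "open U" "open W" "A \<inter> ?I \<subseteq> U" "B \<inter> ?I \<subseteq> W" "U \<inter> W = {}"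
    using t4_space[of "A \<inter> ?I" "B \<inter> ?I"] by blast
  have "\<exists>n. K n \<subseteq> U \<union> W"
  proof (rule ccontr)
    assume no: "\<nexists>n. K n \<subseteq> U \<union> W"
    have "K 0 \<inter> (\<Inter>n\<in>UNIV. K n - (U \<union> W)) \<noteq> {}"
    proof (rule compact_imp_fip_image[OF comp])
      show "closed (K n - (U \<union> W))" for n
        using comp UW by (simp add: closed_Diff compact_imp_closed open_Un)
      fix N :: "nat set" assume "finite N"
      then have "K (Max (insert 0 N)) \<subseteq> K n" if "n \<in> insert 0 N" for n
        using that by (intro dec Max_ge) auto
      moreover obtain z where "z \<in> K (Max (insert 0 N)) - (U \<union> W)" using no by blast
      ultimately have "z \<in> K 0 \<inter> (\<Inter>n\<in>N. K n - (U \<union> W))" by blast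
      then show "K 0 \<inter> (\<Inter>n\<in>N. K n - (U \<union> W)) \<noteq> {}" by blast
    qed
    then show False using AB(3) UW(3,4) by blast
  qed
  then obtain n where n: "K n \<subseteq> U \<union> W" by blast
  have "U \<inter> K n \<noteq> {}" "W \<inter> K n \<noteq> {}" using AB(5,6) UW(3,4) by blast+
  then show False
    using connectedD[OF conn[of n] UW(1,2)] UW(5) n by blast
qed

context
  fixes X :: "'a::metric_space set" and f :: "'a \<Rightarrow> 'b::metric_space"
  assumes field: "metric_field X f"
begin

lemma paths_between_nonempty:
  assumes "x \<in> X" "y \<in> X"
  shows "paths_between X x y \<noteq> {}"
proof -
  have "path_component X x y"
    using field assms
    by (simp add: metric_field_def path_component_eq_connected_component
        connected_iff_connected_component)
  then show ?thesis by (auto simp: path_component_def paths_between_def)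
qed

lemma bdd_above_along_path:
  assumes "\<gamma> \<in> paths_between X x y"
  shows "bdd_above ((\<lambda>t. dist c (f (\<gamma> t))) ` {0..1})"
proof -
  have "continuous_on {0..1} (\<lambda>t. f (\<gamma> t))"
    by (rule continuous_on_compose2[where t = X and g = f])
       (use field assms in \<open>auto simp: metric_field_def paths_between_def path_def path_image_def\<close>)
  then have "continuous_on {0..1} (\<lambda>t. dist c (f (\<gamma> t)))"
    by (rule continuous_on_dist[OF continuous_on_const])
  then have "compact ((\<lambda>t. dist c (f (\<gamma> t))) ` {0..1})"
    by (rule compact_continuous_image) simp
  then show ?thesis by (simp add: bounded_imp_bdd_above compact_imp_bounded)
qed

lemma cost_le_iff:
  assumes "\<gamma> \<in> paths_between X x y"
  shows "(SUP t\<in>{0..1}. dist c (f (\<gamma> t))) \<le> r \<longleftrightarrow> (\<forall>z\<in>path_image \<gamma>. dist c (f z) \<le> r)"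
  using cSUP_le_iff[OF _ bdd_above_along_path[OF assms]] by (auto simp: path_image_def)

lemma dist_le_cost:
  assumes "\<gamma> \<in> paths_between X x y"
  shows "dist (f x) (f y) \<le> (SUP t\<in>{0..1}. dist (f x) (f (\<gamma> t)))"
proof -
  have "y \<in> path_image \<gamma>" using assms by (auto simp: paths_between_def)
  then show ?thesis using cost_le_iff[OF assms, of "f x"] by blast
qed

lemma bdd_below_costs:
  "bdd_below ((\<lambda>\<gamma>. SUP t\<in>{0..1}. dist (f x) (f (\<gamma> t))) ` paths_between X x y)"
  by (rule bdd_belowI2[where m = "dist (f x) (f y)"]) (rule dist_le_cost)

lemma reeb_radius_le:
  assumes "\<gamma> \<in> paths_between X x y" "\<And>z. z \<in> path_image \<gamma> \<Longrightarrow> dist (f x) (f z) \<le> r"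
  shows "reeb_radius X f x y \<le> r"
  unfolding reeb_radius_def
  using cINF_lower[OF bdd_below_costs assms(1)] cost_le_iff[OF assms(1), of "f x" r] assms(2)
  by fastforce

lemma reeb_radius_less_path:
  assumes "x \<in> X" "y \<in> X" "reeb_radius X f x y < r"
  obtains \<gamma> where "\<gamma> \<in> paths_between X x y" "\<And>z. z \<in> path_image \<gamma> \<Longrightarrow> dist (f x) (f z) \<le> r"
proof -
  obtain \<gamma> where \<gamma>: "\<gamma> \<in> paths_between X x y" "(SUP t\<in>{0..1}. dist (f x) (f (\<gamma> t))) < r"
    using assms cINF_less_iff[OF paths_between_nonempty bdd_below_costs]
    unfolding reeb_radius_def by blast
  then show ?thesis using that cost_le_iff[OF \<gamma>(1), of "f x" r] by force
qed

lemma dist_le_reeb_radius: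
  assumes "x \<in> X" "y \<in> X"
  shows "dist (f x) (f y) \<le> reeb_radius X f x y"
  unfolding reeb_radius_def
  by (intro cINF_greatest paths_between_nonempty assms dist_le_cost)

lemma reeb_radius_trans:
  assumes "x \<in> X" "y \<in> X" "z \<in> X"
  shows "reeb_radius X f x z \<le> max (reeb_radius X f x y) (dist (f x) (f y) + reeb_radius X f y z)"
proof (rule field_le_epsilon)
  fix e :: real assume e: "e > 0"
  obtain \<gamma> where \<gamma>: "\<gamma> \<in> paths_between X x y"
      "\<And>u. u \<in> path_image \<gamma> \<Longrightarrow> dist (f x) (f u) \<le> reeb_radius X f x y + e"
    using reeb_radius_less_path[OF assms(1,2), of "reeb_radius X f x y + e"] e by auto
  obtain \<eta> where \<eta>: "\<eta> \<in> paths_between X y z"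
      "\<And>u. u \<in> path_image \<eta> \<Longrightarrow> dist (f y) (f u) \<le> reeb_radius X f y z + e"
    using reeb_radius_less_path[OF assms(2,3), of "reeb_radius X f y z + e"] e by auto
  have j: "\<gamma> +++ \<eta> \<in> paths_between X x z" and i: "path_image (\<gamma> +++ \<eta>) = path_image \<gamma> \<union> path_image \<eta>"
    using \<gamma>(1) \<eta>(1) by (auto simp: paths_between_def path_image_join)
  show "reeb_radius X f x z
      \<le> max (reeb_radius X f x y) (dist (f x) (f y) + reeb_radius X f y z) + e"
  proof (rule reeb_radius_le[OF j])
    fix u assume "u \<in> path_image (\<gamma> +++ \<eta>)"
    then show "dist (f x) (f u)
        \<le> max (reeb_radius X f x y) (dist (f x) (f y) + reeb_radius X f y z) + e"
      using \<gamma>(2)[of u] \<eta>(2)[of u] dist_triangle[of "f x" "f u" "f y"] unfolding i by force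
  qed
qed

lemma reeb_rel_iff_radius_0:
  "(x, y) \<in> reeb_rel X f \<longleftrightarrow> x \<in> X \<and> y \<in> X \<and> reeb_radius X f x y = 0"
proof
  have cont: "continuous_on X (\<lambda>z. dist (f x) (f z))"
    using field continuous_on_dist[OF continuous_on_const] by (auto simp: metric_field_def)
  assume "(x, y) \<in> reeb_rel X f"
  then have xy: "x \<in> X" "y \<in> X" and cc: "connected_component {z \<in> X. f z = f x} x y"
    by (auto simp: reeb_rel_def)
  have "reeb_radius X f x y \<le> e" if e: "e > 0" for e
  proof -
    let ?U = "{z \<in> X. dist (f x) (f z) < e}"
    have "openin (top_of_set X) (X \<inter> (\<lambda>z. dist (f x) (f z)) -` {..<e})"
      by (rule continuous_openin_preimage_gen[OF cont]) simp
    moreover have "X \<inter> (\<lambda>z. dist (f x) (f z)) -` {..<e} = ?U" by auto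
    ultimately have "locally path_connected ?U"
      using field locally_open_subset by (metis metric_field_def)
    moreover have "connected_component ?U x y"
      by (rule connected_component_of_subset[OF cc]) (use e in auto)
    ultimately have "path_component ?U x y"
      by (simp add: path_component_eq_connected_component)
    then obtain \<gamma> where "path \<gamma>" "path_image \<gamma> \<subseteq> ?U" "pathstart \<gamma> = x" "pathfinish \<gamma> = y"
      by (auto simp: path_component_def)
    then show ?thesis
      by (intro reeb_radius_le[of \<gamma>]) (auto simp: paths_between_def)
  qed
  then have "reeb_radius X f x y \<le> 0" by (rule field_le_epsilon) simp
  moreover have "0 \<le> reeb_radius X f x y"
    using dist_le_reeb_radius[OF xy] zero_le_dist order_trans by blast
  ultimately show "x \<in> X \<and> y \<in> X \<and> reeb_radius X f x y = 0" using xy by simp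
next
  have cont: "continuous_on X (\<lambda>z. dist (f x) (f z))"
    using field continuous_on_dist[OF continuous_on_const] by (auto simp: metric_field_def)
  assume R: "x \<in> X \<and> y \<in> X \<and> reeb_radius X f x y = 0"
  then have xy: "x \<in> X" "y \<in> X" and 0: "reeb_radius X f x y = 0" by auto
  define S where "S n = {z \<in> X. dist (f x) (f z) \<le> inverse (real (Suc n))}" for n
  define K where "K n = connected_component_set (S n) x" for n
  have xS: "x \<in> S n" for n using xy by (simp add: S_def)
  have "closedin (top_of_set X) (X \<inter> (\<lambda>z. dist (f x) (f z)) -` {..inverse (real (Suc n))})" for n
    by (rule continuous_closedin_preimage[OF cont]) simp
  moreover have "X \<inter> (\<lambda>z. dist (f x) (f z)) -` {..inverse (real (Suc n))} = S n" for n
    by (auto simp: S_def)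
  ultimately have "compact (S n)" for n
    using field closedin_compact by (metis metric_field_def)
  then have compK: "compact (K n)" for n
    unfolding K_def using closedin_compact closedin_connected_component by blast
  have decS: "S n \<subseteq> S m" if "m \<le> n" for m n
  proof -
    have "inverse (real (Suc n)) \<le> inverse (real (Suc m))"
      using that by (intro le_imp_inverse_le) auto
    then show ?thesis unfolding S_def using order_trans by blast
  qed
  have decK: "K n \<subseteq> K m" if "m \<le> n" for m n
    unfolding K_def using connected_component_mono[OF decS[OF that]] .
  have "connected (\<Inter> (range K))"
    by (rule connected_nested_compact[OF compK _ decK]) (simp_all add: K_def)
  moreover have "x \<in> \<Inter> (range K)" using xS by (simp add: K_def)
  moreover have "y \<in> \<Inter> (range K)"
  proof safe
    fix n
    obtain \<gamma> where \<gamma>: "\<gamma> \<in> paths_between X x y"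
        "\<And>z. z \<in> path_image \<gamma> \<Longrightarrow> dist (f x) (f z) \<le> inverse (real (Suc n))"
      using reeb_radius_less_path[OF xy, of "inverse (real (Suc n))"] 0 by auto
    then have "path_image \<gamma> \<subseteq> S n" by (auto simp: S_def paths_between_def)
    moreover have "connected (path_image \<gamma>)" "x \<in> path_image \<gamma>" "y \<in> path_image \<gamma>"
      using \<gamma>(1) by (auto simp: paths_between_def connected_path_image)
    ultimately show "y \<in> K n" by (auto simp: K_def connected_component_def)
  qed
  moreover have "\<Inter> (range K) \<subseteq> {z \<in> X. f z = f x}"
  proof
    fix z assume z: "z \<in> \<Inter> (range K)"
    then have S: "z \<in> S n" for n using connected_component_subset by (fastforce simp: K_def)
    have "\<not> 0 < dist (f x) (f z)"
    proof
      assume "0 < dist (f x) (f z)"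
      then obtain n where "inverse (real (Suc n)) < dist (f x) (f z)"
        using reals_Archimedean by blast
      then show False using S[of n] by (simp add: S_def)
    qed
    then show "z \<in> {z \<in> X. f z = f x}" using S[of 0] by (auto simp: S_def)
  qed
  ultimately have "connected_component {z \<in> X. f z = f x} x y"
    unfolding connected_component_def by blast
  then show "(x, y) \<in> reeb_rel X f" using xy by (simp add: reeb_rel_def)
qed

lemma reeb_radius_cong:
  assumes "(x, x') \<in> reeb_rel X f" "(y, y') \<in> reeb_rel X f"
  shows "reeb_radius X f x y = reeb_radius X f x' y'"
proof -
  have le: "reeb_radius X f a b \<le> reeb_radius X f a' b'"
    if "(a', a) \<in> reeb_rel X f" "(b', b) \<in> reeb_rel X f" for a a' b b'
  proof -
    have "(a, a') \<in> reeb_rel X f"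
      using that(1) equiv_reeb_rel[of X f] by (meson equivE symE)
    then have a: "a \<in> X" "a' \<in> X" "reeb_radius X f a a' = 0" "f a' = f a"
      using reeb_rel_iff_radius_0 dist_le_reeb_radius[of a a'] by auto
    have b: "b \<in> X" "b' \<in> X" "reeb_radius X f b' b = 0"
      using that(2) reeb_rel_iff_radius_0 by auto
    show ?thesis
      using reeb_radius_trans[of a a' b] reeb_radius_trans[of a' b' b]
        dist_le_reeb_radius[of a' b'] order_trans[OF zero_le_dist dist_le_reeb_radius[of a' b']] a b
      by (simp add: max_def split: if_splits)
  qed
  show ?thesis
    using le[of x x' y y'] le[of x' x y' y] assms equiv_reeb_rel[of X f]
    by (meson antisym equivE symE)
qed

lemma reeb_dist_class:
  assumes "x \<in> X" "y \<in> X"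
  shows "reeb_dist X f (reeb_rel X f `` {x}) (reeb_rel X f `` {y}) =
    2 * max (reeb_radius X f x y) (reeb_radius X f y x)"
proof -
  note r = rep_equiv_class[OF equiv_reeb_rel[of X f]]
  show ?thesis
    using reeb_radius_cong[OF r[OF assms(1)] r[OF assms(2)]]
      reeb_radius_cong[OF r[OF assms(2)] r[OF assms(1)]]
    by (simp add: reeb_dist_def)
qed

lemma reeb_decoration_class:
  assumes "x \<in> X"
  shows "\<exists>p. reeb_decoration X f (reeb_rel X f `` {x}) = (X, dist, p) \<and>
    (\<forall>y\<in>X. p y = reeb_radius X f x y)"
proof -
  note r = rep_equiv_class[OF equiv_reeb_rel[of X f]]
  have "(y, y) \<in> reeb_rel X f" if "y \<in> X" for y
    using that equiv_reeb_rel[of X f] by (meson equivE refl_onD)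
  then have "reeb_radius X f (rep (reeb_rel X f `` {x})) y = reeb_radius X f x y" if "y \<in> X" for y
    using reeb_radius_cong[OF r[OF assms], of y y] that by simp
  then show ?thesis by (simp add: reeb_decoration_def)
qed

end

section \<open>Independence of representatives: connected graphs\<close>

context
  fixes V :: "'a set" and E :: "'a set set" and g :: "'a \<Rightarrow> 'b::metric_space"
  assumes finV: "finite V"
    and conn: "\<And>v w. v \<in> V \<Longrightarrow> w \<in> V \<Longrightarrow> edge_paths V E v w \<noteq> {}"
begin

lemma finite_graph_costs:
  "finite ((\<lambda>vs. Max ((\<lambda>u. dist (g v) (g u)) ` set vs)) ` edge_paths V E v w)"
proof (rule finite_subset)
  show "(\<lambda>vs. Max ((\<lambda>u. dist (g v) (g u)) ` set vs)) ` edge_paths V E v w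
      \<subseteq> (\<lambda>u. dist (g v) (g u)) ` V"
  proof safe
    fix vs assume "vs \<in> edge_paths V E v w"
    then have vs: "vs \<noteq> []" "set vs \<subseteq> V" by (auto simp: edge_paths_def)
    then have "Max ((\<lambda>u. dist (g v) (g u)) ` set vs) \<in> (\<lambda>u. dist (g v) (g u)) ` set vs"
      by (intro Max_in) auto
    then show "Max ((\<lambda>u. dist (g v) (g u)) ` set vs) \<in> (\<lambda>u. dist (g v) (g u)) ` V"
      using vs(2) by (rule subsetD[OF image_mono, rotated])
  qed
qed (simp add: finV)

lemma graph_reeb_radius_le_iff:
  assumes "v \<in> V" "w \<in> V"
  shows "graph_reeb_radius V E g v w \<le> r \<longleftrightarrow>
    (\<exists>vs\<in>edge_paths V E v w. \<forall>u\<in>set vs. dist (g v) (g u) \<le> r)"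
proof -
  have "Max ((\<lambda>u. dist (g v) (g u)) ` set vs) \<le> r \<longleftrightarrow> (\<forall>u\<in>set vs. dist (g v) (g u) \<le> r)"
    if "vs \<in> edge_paths V E v w" for vs
    using that by (subst Max_le_iff) (auto simp: edge_paths_def)
  then show ?thesis
    unfolding graph_reeb_radius_def using conn[OF assms] finite_graph_costs
    by (subst Min_le_iff) auto
qed

lemma dist_le_graph_reeb_radius:
  assumes "v \<in> V" "w \<in> V"
  shows "dist (g v) (g w) \<le> graph_reeb_radius V E g v w"
  using graph_reeb_radius_le_iff[OF assms, of "graph_reeb_radius V E g v w"]
  by (auto simp: edge_paths_def)

lemma graph_reeb_radius_trans:
  assumes "u \<in> V" "v \<in> V" "w \<in> V"
  shows "graph_reeb_radius V E g u w
    \<le> max (graph_reeb_radius V E g u v) (dist (g u) (g v) + graph_reeb_radius V E g v w)"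
proof -
  obtain vs where vs: "vs \<in> edge_paths V E u v"
      "\<And>z. z \<in> set vs \<Longrightarrow> dist (g u) (g z) \<le> graph_reeb_radius V E g u v"
    using graph_reeb_radius_le_iff[OF assms(1,2)] by blast
  obtain ws where ws: "ws \<in> edge_paths V E v w"
      "\<And>z. z \<in> set ws \<Longrightarrow> dist (g v) (g z) \<le> graph_reeb_radius V E g v w"
    using graph_reeb_radius_le_iff[OF assms(2,3)] by blast
  obtain ws' where ws': "ws = v # ws'"
    using ws(1) by (cases ws) (auto simp: edge_paths_def)
  have "vs @ ws' \<in> edge_paths V E u w"
    using vs(1) ws(1) unfolding ws'
    by (auto simp: edge_paths_def successively_append_iff successively_Cons split: if_splits)
  moreover have "dist (g u) (g z)
      \<le> max (graph_reeb_radius V E g u v) (dist (g u) (g v) + graph_reeb_radius V E g v w)"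
    if "z \<in> set (vs @ ws')" for z
    using that vs(2)[of z] ws(2)[of z] dist_triangle[of "g u" "g z" "g v"] unfolding ws' by force
  ultimately show ?thesis using graph_reeb_radius_le_iff[OF assms(1,3)] by blast
qed

lemma graph_reeb_rel_sym:
  assumes "(v, w) \<in> graph_reeb_rel V E g"
  shows "(w, v) \<in> graph_reeb_rel V E g"
proof -
  have vw: "v \<in> V" "w \<in> V" "graph_reeb_radius V E g v w = 0"
    using assms by (auto simp: graph_reeb_rel_def)
  then obtain vs where vs: "vs \<in> edge_paths V E v w" "\<And>u. u \<in> set vs \<Longrightarrow> g u = g v"
    using graph_reeb_radius_le_iff[of v w 0] by auto
  have "rev vs \<in> edge_paths V E w v"
    using vs(1) by (auto simp: edge_paths_def hd_rev last_rev insert_commute)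
  moreover have "w \<in> set vs" using vs(1) last_in_set[of vs] by (auto simp: edge_paths_def)
  then have "dist (g w) (g u) \<le> 0" if "u \<in> set (rev vs)" for u
    using vs(2)[of w] vs(2)[of u] that by simp
  ultimately have "graph_reeb_radius V E g w v \<le> 0"
    using graph_reeb_radius_le_iff[OF vw(2,1)] by blast
  then show ?thesis
    using vw dist_le_graph_reeb_radius[of w v] order_trans[OF zero_le_dist dist_le_graph_reeb_radius[of w v]]
    by (simp add: graph_reeb_rel_def)
qed

lemma graph_reeb_radius_cong:
  assumes "(v, v') \<in> graph_reeb_rel V E g" "(w, w') \<in> graph_reeb_rel V E g"
  shows "graph_reeb_radius V E g v w = graph_reeb_radius V E g v' w'"
proof -
  have le: "graph_reeb_radius V E g a b \<le> graph_reeb_radius V E g a' b'"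
    if "(a', a) \<in> graph_reeb_rel V E g" "(b', b) \<in> graph_reeb_rel V E g" for a a' b b'
  proof -
    have a: "a \<in> V" "a' \<in> V" "graph_reeb_radius V E g a a' = 0"
      using graph_reeb_rel_sym[OF that(1)] by (auto simp: graph_reeb_rel_def)
    then have "g a' = g a" using dist_le_graph_reeb_radius[of a a'] by auto
    moreover have b: "b \<in> V" "b' \<in> V" "graph_reeb_radius V E g b' b = 0"
      using that(2) by (auto simp: graph_reeb_rel_def)
    ultimately show ?thesis
      using graph_reeb_radius_trans[of a a' b] graph_reeb_radius_trans[of a' b' b]
        dist_le_graph_reeb_radius[of a' b']
        order_trans[OF zero_le_dist dist_le_graph_reeb_radius[of a' b']] a
      by (simp add: max_def split: if_splits)
  qed
  show ?thesis
    using le[of v v' w w'] le[of v' v w' w] assms graph_reeb_rel_sym by (meson antisym)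
qed

lemma equiv_graph_reeb_rel: "equiv V (graph_reeb_rel V E g)"
proof (rule equivI)
  show "graph_reeb_rel V E g \<subseteq> V \<times> V" by (auto simp: graph_reeb_rel_def)
  have "graph_reeb_radius V E g v v = 0" if v: "v \<in> V" for v
  proof (rule antisym)
    show "graph_reeb_radius V E g v v \<le> 0"
      using graph_reeb_radius_le_iff[OF v v, of 0] v
      by (auto simp: edge_paths_def intro!: exI[of _ "[v]"])
    show "0 \<le> graph_reeb_radius V E g v v"
      using dist_le_graph_reeb_radius[OF v v] by simp
  qed
  then show "refl_on V (graph_reeb_rel V E g)"
    by (auto simp: refl_on_def graph_reeb_rel_def)
  then have refl: "(v, v) \<in> graph_reeb_rel V E g" if "v \<in> V" for v
    using that by (meson refl_onD)
  show "sym (graph_reeb_rel V E g)" by (rule symI) (rule graph_reeb_rel_sym)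
  show "trans (graph_reeb_rel V E g)"
  proof (rule transI)
    fix u v w assume uv: "(u, v) \<in> graph_reeb_rel V E g" and vw: "(v, w) \<in> graph_reeb_rel V E g"
    have w: "w \<in> V" using vw by (simp add: graph_reeb_rel_def)
    show "(u, w) \<in> graph_reeb_rel V E g"
      using graph_reeb_radius_cong[OF uv refl[OF w]] uv vw by (simp add: graph_reeb_rel_def)
  qed
qed

lemma graph_reeb_dist_class:
  assumes "v \<in> V" "w \<in> V"
  shows "graph_reeb_dist V E g (graph_reeb_rel V E g `` {v}) (graph_reeb_rel V E g `` {w}) =
    2 * max (graph_reeb_radius V E g v w) (graph_reeb_radius V E g w v)"
proof -
  note r = rep_equiv_class[OF equiv_graph_reeb_rel]
  show ?thesis
    using graph_reeb_radius_cong[OF r[OF assms(1)] r[OF assms(2)]]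
      graph_reeb_radius_cong[OF r[OF assms(2)] r[OF assms(1)]]
    by (simp add: graph_reeb_dist_def)
qed

end

lemma graph_reeb_decoration_class:
  fixes V :: "'a::metric_space set" and g :: "'a \<Rightarrow> 'b::metric_space"
  assumes "finite V" "\<And>v w. v \<in> V \<Longrightarrow> w \<in> V \<Longrightarrow> edge_paths V E v w \<noteq> {}" "v \<in> V"
  shows "\<exists>q. graph_reeb_decoration V E g (graph_reeb_rel V E g `` {v}) = (V, dist, q) \<and>
    (\<forall>w\<in>V. q w = graph_reeb_radius V E g v w)"
proof -
  note equiv = equiv_graph_reeb_rel[OF assms(1,2), of g]
  have "(w, w) \<in> graph_reeb_rel V E g" if "w \<in> V" for w
    using that equiv by (meson equivE refl_onD)
  then have "graph_reeb_radius V E g (rep (graph_reeb_rel V E g `` {v})) w =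
      graph_reeb_radius V E g v w" if "w \<in> V" for w
    using graph_reeb_radius_cong[OF assms(1,2) rep_equiv_class[OF equiv assms(3)], of w w] that
    by simp
  then show ?thesis by (simp add: graph_reeb_decoration_def)
qed

end

theory Submission
  imports Defs
begin

text \<open>Call a point \<open>x\<close> of \<open>X\<close> and a vertex \<open>v\<close> nearby if they are at distance at most
  \<open>\<delta>\<close>, both in \<open>X\<close> and after applying \<open>f\<close>. This one relation induces all the correspondences
  asked for: on the filtered spaces it is used as it is, and on the Reeb spaces by passing to
  classes. Its metric distortion is at most \<open>2 * \<delta>\<close> by the triangle inequality, so everything
  reduces to a comparison of radii: if \<open>x\<close>, \<open>v\<close> and \<open>y\<close>, \<open>w\<close> are nearby, then the radius of
  \<open>x, y\<close> in the field and that of \<open>v, w\<close> in the graph differ by at most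
  \<open>(5 * L + 1) * \<delta> + 3 * \<epsilon>\<close>.

  From graph to field (\<open>reeb_radius_le_graph_reeb_radius\<close>): a cheapest walk from \<open>v\<close> to \<open>w\<close> has
  steps of length at most \<open>3 * \<delta>\<close>, so by connectivity each step can be replaced by a path along
  which \<open>f\<close> moves by hardly more than \<open>3 * L * \<delta> + 2 * \<epsilon>\<close>; moving the base point from \<open>v\<close>
  to \<open>x\<close> costs another \<open>\<delta>\<close>.

  From field to graph (\<open>graph_reeb_radius_le_reeb_radius\<close>): a path from \<open>x\<close> to \<open>y\<close> is shadowed
  by a walk from \<open>v\<close> to \<open>w\<close> whose vertices are all nearby to points of the path
  (\<open>walk_shadowing_connected_set\<close>). Replacing path points by vertices costs \<open>\<delta>\<close>. Replacing the
  base point \<open>x\<close> by \<open>v\<close> costs another \<open>\<delta>\<close> by nearness, which would be too much for small \<open>L\<close> and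
  \<open>\<epsilon>\<close>; but connectivity bounds the same distance by \<open>L * \<delta> + 2 * \<epsilon>\<close>, and this is within the
  allowance.\<close>

section \<open>Nearby vertices and shadowing walks\<close>

definition nearby ::
    "'a::metric_space set \<Rightarrow> 'a set \<Rightarrow> ('a \<Rightarrow> 'b::metric_space) \<Rightarrow> real \<Rightarrow> ('a \<times> 'a) set" where
  "nearby X V f \<delta> = {(x, v). x \<in> X \<and> v \<in> V \<and> dist x v \<le> \<delta> \<and> dist (f x) (f v) \<le> \<delta>}"

lemma nearbyD:
  assumes "(x, v) \<in> nearby X V f \<delta>"
  shows "x \<in> X" "v \<in> V" "dist x v \<le> \<delta>" "dist (f x) (f v) \<le> \<delta>"
  using assms by (auto simp: nearby_def)

lemma edge_paths_snoc:
  assumes "vs \<in> edge_paths V E v u" "u' \<in> V" "u = u' \<or> {u, u'} \<in> E"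
  shows "\<exists>vs'\<in>edge_paths V E v u'. set vs' \<subseteq> insert u' (set vs)"
proof (cases "u = u'")
  case True
  then show ?thesis using assms(1) by blast
next
  case False
  then have "vs @ [u'] \<in> edge_paths V E v u'"
    using assms by (auto simp: edge_paths_def successively_append_iff)
  then show ?thesis by (rule bexI[rotated]) auto
qed

text \<open>Having a good walk to every vertex close to \<open>z\<close> is a property of \<open>z\<close> that passes to all
  points within distance \<open>\<delta>\<close>: two vertices close to such points are at distance at most
  \<open>3 * \<delta>\<close>, hence equal or adjacent. A property that spreads over balls of a fixed radius holds
  on all of a connected set, so there is no need to subdivide a path.\<close>

lemma walk_shadowing_connected_set:
  fixes S V :: "'a::metric_space set"
  assumes "connected S" and "\<delta> > 0"
    and edge: "\<And>u u'. u \<in> V \<Longrightarrow> u' \<in> V \<Longrightarrow> u \<noteq> u' \<Longrightarrow> dist u u' \<le> 3 * \<delta> \<Longrightarrow> {u, u'} \<in> E"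
    and N: "\<And>z u. (z, u) \<in> N \<Longrightarrow> u \<in> V \<and> dist z u \<le> \<delta>"
    and cover: "\<And>z. z \<in> S \<Longrightarrow> \<exists>u. (z, u) \<in> N"
    and x: "x \<in> S" "(x, v) \<in> N" and y: "y \<in> S" "(y, w) \<in> N"
  shows "\<exists>vs\<in>edge_paths V E v w. \<forall>u\<in>set vs. \<exists>z\<in>S. (z, u) \<in> N"
proof -
  define good where "good u \<longleftrightarrow> (\<exists>vs\<in>edge_paths V E v u. \<forall>u\<in>set vs. \<exists>z\<in>S. (z, u) \<in> N)" for u
  have good_step: "good u'"
    if z: "(z, u) \<in> N" "z' \<in> S" "(z', u') \<in> N" "dist z z' \<le> \<delta>" and u: "good u" for z z' u u'
  proof -
    obtain vs where vs: "vs \<in> edge_paths V E v u" "\<forall>u\<in>set vs. \<exists>z\<in>S. (z, u) \<in> N"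
      using u good_def by blast
    have "dist u u' \<le> dist z u + dist z z' + dist z' u'"
      using dist_triangle[of u u' z] dist_triangle[of z u' z'] by (simp add: dist_commute)
    then have "dist u u' \<le> 3 * \<delta>" using N[OF z(1)] N[OF z(3)] z(4) by linarith
    then have "u = u' \<or> {u, u'} \<in> E" using edge N[OF z(1)] N[OF z(3)] by blast
    then obtain vs' where "vs' \<in> edge_paths V E v u'" "set vs' \<subseteq> insert u' (set vs)"
      using edge_paths_snoc[OF vs(1)] N[OF z(3)] by blast
    then show ?thesis unfolding good_def using vs(2) z(2,3) by blast
  qed
  have "good v"
    unfolding good_def using x N[OF x(2)] by (intro bexI[of _ "[v]"]) (auto simp: edge_paths_def)
  then have base: "\<forall>u. (x, u) \<in> N \<longrightarrow> good u"
    using good_step[OF x(2) x(1)] assms(2) by auto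
  have "\<forall>u. (y, u) \<in> N \<longrightarrow> good u"
  proof (rule connected_induction_simple[where P = "\<lambda>z. \<forall>u. (z, u) \<in> N \<longrightarrow> good u",
        OF assms(1) x(1) y(1) base])
    fix a assume a: "a \<in> S"
    let ?T = "S \<inter> ball a (\<delta> / 2)"
    have spread: "\<forall>u. (z', u) \<in> N \<longrightarrow> good u"
      if z: "z \<in> ?T" "z' \<in> ?T" "\<forall>u. (z, u) \<in> N \<longrightarrow> good u" for z z'
    proof -
      have "dist z z' \<le> \<delta>"
        using z(1,2) dist_triangle[of z z' a] by (simp add: dist_commute)
      moreover obtain u where "(z, u) \<in> N" "good u" using cover[of z] z by blast
      ultimately show ?thesis using good_step z(2) by blast
    qed
    have "openin (top_of_set S) ?T" "a \<in> ?T"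
      using a assms(2) by (auto simp: openin_open)
    then show "\<exists>T. openin (top_of_set S) T \<and> a \<in> T \<and>
        (\<forall>x\<in>T. \<forall>y\<in>T. (\<forall>u. (x, u) \<in> N \<longrightarrow> good u) \<longrightarrow> (\<forall>u. (y, u) \<in> N \<longrightarrow> good u))"
      using spread by (intro exI[of _ ?T] conjI ballI impI) blast+
  qed
  then show ?thesis using y(2) good_def by blast
qed

section \<open>Field radii from graph walks\<close>

text \<open>Filling in the steps of a walk by paths costs only once, not once per step: the radius
  measures the distance from the base point \<open>x\<close>, and every filled-in path starts at a vertex
  whose value is within \<open>r\<close> of that of \<open>x\<close>.\<close>

lemma reeb_radius_along_chain:
  assumes field: "metric_field X f"
    and "x \<in> X" and "vs \<noteq> []" and "set vs \<subseteq> X"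
    and "\<And>u. u \<in> set vs \<Longrightarrow> dist (f x) (f u) \<le> r"
    and "successively (\<lambda>u u'. reeb_radius X f u u' \<le> c) vs"
    and "reeb_radius X f x (hd vs) \<le> r + c"
  shows "reeb_radius X f x (last vs) \<le> r + c"
  using assms(3-)
proof (induction vs)
  case (Cons u vs)
  show ?case
  proof (cases vs)
    case Nil
    then show ?thesis using Cons.prems by simp
  next
    case (Cons u' vs')
    have u: "dist (f x) (f u) \<le> r" "reeb_radius X f u u' \<le> c" "reeb_radius X f x u \<le> r + c"
      using Cons.prems Cons by auto
    have "reeb_radius X f x u' \<le> max (reeb_radius X f x u) (dist (f x) (f u) + reeb_radius X f u u')"
      using Cons.prems Cons by (intro reeb_radius_trans[OF field assms(2)]) auto
    also have "\<dots> \<le> r + c" using u by simp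
    finally have "reeb_radius X f x (last vs) \<le> r + c"
      using Cons.prems Cons by (intro Cons.IH) auto
    then show ?thesis using Cons by simp
  qed
qed simp

lemma connectivityD:
  assumes "connectivity L \<epsilon> X f" "L \<ge> 0" "x \<in> X" "y \<in> X" "dist x y \<le> a"
  shows "reeb_radius X f x y \<le> L * a + 2 * \<epsilon>"
  using assms mult_left_mono[OF assms(5,2)] unfolding connectivity_def by fastforce

text \<open>The factor \<open>3\<close> of \<open>L\<close> is the edge length in units of \<open>\<delta>\<close>; the short ways from \<open>x\<close> to
  \<open>v\<close> and from \<open>w\<close> to \<open>y\<close> are covered by the same allowance.\<close>

lemma reeb_radius_le_graph_reeb_radius:
  assumes field: "metric_field X f" and C: "connectivity L \<epsilon> X f" and "L \<ge> 0" "\<delta> > 0"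
    and V: "V \<subseteq> X" "finite V"
    and walks: "\<And>v w. v \<in> V \<Longrightarrow> w \<in> V \<Longrightarrow> edge_paths V E v w \<noteq> {}"
    and edge: "\<And>u u'. {u, u'} \<in> E \<Longrightarrow> dist u u' \<le> 3 * \<delta>"
    and g: "\<And>v. v \<in> V \<Longrightarrow> g v = f v"
    and xv: "(x, v) \<in> nearby X V f \<delta>" and yw: "(y, w) \<in> nearby X V f \<delta>"
  shows "reeb_radius X f x y \<le> graph_reeb_radius V E g v w + (3 * L + 1) * \<delta> + 2 * \<epsilon>"
proof -
  note x = nearbyD[OF xv] and y = nearbyD[OF yw]
  let ?G = "graph_reeb_radius V E g v w"
  define r where "r = \<delta> + ?G"
  define c where "c = L * (3 * \<delta>) + 2 * \<epsilon>"
  obtain vs where vs: "vs \<in> edge_paths V E v w" "\<And>u. u \<in> set vs \<Longrightarrow> dist (g v) (g u) \<le> ?G"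
    using graph_reeb_radius_le_iff[OF V(2) walks x(2) y(2), where r = ?G] by blast
  have vs': "vs \<noteq> []" "set vs \<subseteq> V" "hd vs = v" "last vs = w"
      "successively (\<lambda>u u'. {u, u'} \<in> E) vs"
    using vs(1) by (auto simp: edge_paths_def)
  have fr: "dist (f x) (f u) \<le> r" if "u \<in> set vs" for u
    using vs(2)[OF that] x(4) dist_triangle[of "f x" "f u" "f v"] g x(2) vs'(2) that
    unfolding r_def by force
  have "r \<ge> 0" using fr[of v] vs'(1,3) order_trans[OF zero_le_dist] hd_in_set by metis
  have near: "L * \<delta> + 2 * \<epsilon> \<le> c" using \<open>L \<ge> 0\<close> \<open>\<delta> > 0\<close> by (simp add: c_def mult_left_mono)
  have "reeb_radius X f x (last vs) \<le> r + c"
  proof (rule reeb_radius_along_chain[OF field x(1) vs'(1)])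
    show "set vs \<subseteq> X" using vs' V by blast
    show "successively (\<lambda>u u'. reeb_radius X f u u' \<le> c) vs"
      using vs'(5)
    proof (rule successively_mono)
      fix u u' assume "u \<in> set vs" "u' \<in> set vs" "{u, u'} \<in> E"
      then show "reeb_radius X f u u' \<le> c"
        unfolding c_def using vs'(2) V(1) edge by (intro connectivityD[OF C \<open>L \<ge> 0\<close>]) auto
    qed
    have "reeb_radius X f x v \<le> L * \<delta> + 2 * \<epsilon>"
      using x V by (intro connectivityD[OF C \<open>L \<ge> 0\<close>]) auto
    then show "reeb_radius X f x (hd vs) \<le> r + c" using vs'(3) near \<open>r \<ge> 0\<close> by simp
  qed (rule fr)
  moreover have "reeb_radius X f w y \<le> L * \<delta> + 2 * \<epsilon>"
    using y V by (intro connectivityD[OF C \<open>L \<ge> 0\<close>]) (auto simp: dist_commute)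
  moreover have "dist (f x) (f w) \<le> r" using fr[of w] vs'(1,4) last_in_set by metis
  moreover have "reeb_radius X f x y \<le> max (reeb_radius X f x w) (dist (f x) (f w) + reeb_radius X f w y)"
    using x y V by (intro reeb_radius_trans[OF field]) auto
  ultimately have "reeb_radius X f x y \<le> r + c" using near vs'(4) by simp
  then show ?thesis by (simp add: r_def c_def algebra_simps)
qed

section \<open>Graph radii from field paths\<close>

lemma edge_paths_shadowing_path:
  assumes "\<gamma> \<in> paths_between X x y" and "\<delta> > 0"
    and edge: "\<And>u u'. u \<in> V \<Longrightarrow> u' \<in> V \<Longrightarrow> u \<noteq> u' \<Longrightarrow> dist u u' \<le> 3 * \<delta> \<Longrightarrow> {u, u'} \<in> E"
    and cover: "\<And>z. z \<in> X \<Longrightarrow> \<exists>u. (z, u) \<in> nearby X V f \<delta>"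
    and xv: "(x, v) \<in> nearby X V f \<delta>" and yw: "(y, w) \<in> nearby X V f \<delta>"
  shows "\<exists>vs\<in>edge_paths V E v w. \<forall>u\<in>set vs. \<exists>z\<in>path_image \<gamma>. (z, u) \<in> nearby X V f \<delta>"
proof (rule walk_shadowing_connected_set[OF _ \<open>\<delta> > 0\<close> edge _ _ _ xv _ yw])
  show "connected (path_image \<gamma>)" "x \<in> path_image \<gamma>" "y \<in> path_image \<gamma>"
    using assms(1) by (auto simp: paths_between_def connected_path_image)
  show "\<exists>u. (z, u) \<in> nearby X V f \<delta>" if "z \<in> path_image \<gamma>" for z
    using assms(1) cover that by (auto simp: paths_between_def)
qed (auto simp: nearby_def)

text \<open>Two bounds for the effect of moving between nearby points are combined: \<open>\<delta>\<close> along the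
  walk, and the one from connectivity at the base point.\<close>

lemma graph_reeb_radius_le_reeb_radius:
  assumes field: "metric_field X f" and C: "connectivity L \<epsilon> X f" and "L \<ge> 0" "\<delta> > 0"
    and V: "V \<subseteq> X" "finite V"
    and walks: "\<And>v w. v \<in> V \<Longrightarrow> w \<in> V \<Longrightarrow> edge_paths V E v w \<noteq> {}"
    and edge: "\<And>u u'. u \<in> V \<Longrightarrow> u' \<in> V \<Longrightarrow> u \<noteq> u' \<Longrightarrow> dist u u' \<le> 3 * \<delta> \<Longrightarrow> {u, u'} \<in> E"
    and cover: "\<And>z. z \<in> X \<Longrightarrow> \<exists>u. (z, u) \<in> nearby X V f \<delta>"
    and g: "\<And>v. v \<in> V \<Longrightarrow> g v = f v"
    and xv: "(x, v) \<in> nearby X V f \<delta>" and yw: "(y, w) \<in> nearby X V f \<delta>"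
  shows "graph_reeb_radius V E g v w \<le> reeb_radius X f x y + (L + 1) * \<delta> + 2 * \<epsilon>"
proof (rule field_le_epsilon)
  fix e :: real assume "e > 0"
  note x = nearbyD[OF xv] and y = nearbyD[OF yw]
  let ?F = "reeb_radius X f x y"
  obtain \<gamma> where \<gamma>: "\<gamma> \<in> paths_between X x y"
      "\<And>z. z \<in> path_image \<gamma> \<Longrightarrow> dist (f x) (f z) \<le> ?F + e"
    using reeb_radius_less_path[OF field x(1) y(1), of "?F + e"] \<open>e > 0\<close> by auto
  obtain vs where vs: "vs \<in> edge_paths V E v w"
      "\<And>u. u \<in> set vs \<Longrightarrow> \<exists>z\<in>path_image \<gamma>. (z, u) \<in> nearby X V f \<delta>"
    using edge_paths_shadowing_path[OF \<gamma>(1) \<open>\<delta> > 0\<close> edge cover xv yw] by blast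
  have "dist (f v) (f x) \<le> reeb_radius X f v x"
    using x V by (intro dist_le_reeb_radius[OF field]) auto
  also have "\<dots> \<le> L * \<delta> + 2 * \<epsilon>"
    using x V by (intro connectivityD[OF C \<open>L \<ge> 0\<close>]) (auto simp: dist_commute)
  finally have vx: "dist (f v) (f x) \<le> L * \<delta> + 2 * \<epsilon>" .
  have "dist (g v) (g u) \<le> ?F + (L + 1) * \<delta> + 2 * \<epsilon> + e" if u: "u \<in> set vs" for u
  proof -
    obtain z where z: "z \<in> path_image \<gamma>" "(z, u) \<in> nearby X V f \<delta>" using vs(2)[OF u] by blast
    have "dist (f v) (f u) \<le> dist (f v) (f x) + dist (f x) (f z) + dist (f z) (f u)"
      using dist_triangle[of "f v" "f u" "f x"] dist_triangle[of "f x" "f u" "f z"] by simp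
    also have "\<dots> \<le> (L * \<delta> + 2 * \<epsilon>) + (?F + e) + \<delta>"
      using vx \<gamma>(2)[OF z(1)] nearbyD(4)[OF z(2)] by linarith
    finally show ?thesis using g x(2) nearbyD(2)[OF z(2)] by (simp add: algebra_simps)
  qed
  then show "graph_reeb_radius V E g v w \<le> ?F + (L + 1) * \<delta> + 2 * \<epsilon> + e"
    using graph_reeb_radius_le_iff[OF V(2) walks x(2) y(2)] vs(1) by blast
qed

section \<open>Correspondences of Reeb spaces\<close>

text \<open>Distortion of distances is the same estimate as distortion of decorations, since a Reeb
  distance is twice the maximum of two radii; this is why one number \<open>T\<close> serves for both.\<close>

lemma decorated_correspondence_of_radius_distortion:
  fixes X V :: "'a::metric_space set" and f g :: "'a \<Rightarrow> 'b::metric_space"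
  assumes field: "metric_field X f"
    and V: "finite V" and walks: "\<And>v w. v \<in> V \<Longrightarrow> w \<in> V \<Longrightarrow> edge_paths V E v w \<noteq> {}"
    and N: "correspondence X V N" and N_dist: "\<And>x v. (x, v) \<in> N \<Longrightarrow> dist x v \<le> s"
    and radius: "\<And>x v y w. (x, v) \<in> N \<Longrightarrow> (y, w) \<in> N \<Longrightarrow>
      \<bar>reeb_radius X f x y - graph_reeb_radius V E g v w\<bar> \<le> T"
  shows "decorated_correspondence T s T
      (reeb_space X f) (reeb_dist X f) (reeb_decoration X f)
      (graph_reeb_space V E g) (graph_reeb_dist V E g) (graph_reeb_decoration V E g)
      ((\<lambda>(x, v). (reeb_rel X f `` {x}, graph_reeb_rel V E g `` {v})) ` N)"
    (is "decorated_correspondence _ _ _ _ _ _ _ _ _ (?q ` N)")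
proof -
  have NXV: "x \<in> X" "v \<in> V" if "(x, v) \<in> N" for x v
    using N that by (auto simp: correspondence_def)
  have images: "fst ` ?q ` N = reeb_space X f" "snd ` ?q ` N = graph_reeb_space V E g"
  proof -
    have "fst ` ?q ` N = (\<lambda>x. reeb_rel X f `` {x}) ` fst ` N"
      by (force simp: image_image)
    then show "fst ` ?q ` N = reeb_space X f"
      using N by (auto simp: correspondence_def reeb_space_def quotient_def)
    have "snd ` ?q ` N = (\<lambda>v. graph_reeb_rel V E g `` {v}) ` snd ` N"
      by (force simp: image_image)
    then show "snd ` ?q ` N = graph_reeb_space V E g"
      using N by (auto simp: correspondence_def graph_reeb_space_def quotient_def)
  qed
  then have corr: "correspondence (reeb_space X f) (graph_reeb_space V E g) (?q ` N)"
    unfolding correspondence_def using subset_fst_snd[of "?q ` N"] by simp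
  have distortion: "\<bar>reeb_dist X f (reeb_rel X f `` {x}) (reeb_rel X f `` {y})
      - graph_reeb_dist V E g (graph_reeb_rel V E g `` {v}) (graph_reeb_rel V E g `` {w})\<bar> \<le> 2 * T"
    if "(x, v) \<in> N" "(y, w) \<in> N" for x v y w
    using radius[OF that] radius[OF that(2,1)] NXV[OF that(1)] NXV[OF that(2)]
    by (simp add: reeb_dist_class[OF field] graph_reeb_dist_class[OF V walks])
  have decoration: "filtered_correspondence s T (reeb_decoration X f (reeb_rel X f `` {x}))
      (graph_reeb_decoration V E g (graph_reeb_rel V E g `` {v})) N" if xv: "(x, v) \<in> N" for x v
  proof -
    obtain p where p: "reeb_decoration X f (reeb_rel X f `` {x}) = (X, dist, p)"
        "\<And>y. y \<in> X \<Longrightarrow> p y = reeb_radius X f x y"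
      using reeb_decoration_class[OF field NXV(1)[OF xv]] by blast
    obtain q where q: "graph_reeb_decoration V E g (graph_reeb_rel V E g `` {v}) = (V, dist, q)"
        "\<And>w. w \<in> V \<Longrightarrow> q w = graph_reeb_radius V E g v w"
      using graph_reeb_decoration_class[OF V walks NXV(2)[OF xv], of g] by blast
    have "\<bar>p y - q w\<bar> \<le> T" if "(y, w) \<in> N" for y w
      using radius[OF xv that] p(2) q(2) NXV[OF that] by simp
    moreover have "\<bar>dist y y' - dist w w'\<bar> \<le> 2 * s" if "(y, w) \<in> N" "(y', w') \<in> N" for y w y' w'
      using N_dist[OF that(1)] N_dist[OF that(2)] dist_triangle[of y y' w] dist_triangle[of w y' w']
        dist_triangle[of w w' y] dist_triangle[of y w' y'] dist_commute[of y w] dist_commute[of y' w']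
      by linarith
    ultimately show ?thesis unfolding p(1) q(1) using N by auto
  qed
  show ?thesis
    unfolding decorated_correspondence_def using corr distortion decoration by fast
qed

theorem theorem25:
  fixes X V :: "'a::metric_space set"
    and f g :: "'a \<Rightarrow> 'b::metric_space"
    and E :: "'a set set"
    and L \<epsilon> \<delta> :: real
  assumes "L \<ge> 0" and "\<epsilon> \<ge> 0"
    and "metric_field X f"
    and "connectivity L \<epsilon> X f"
    and "\<delta> > 0"
    and "V \<subseteq> X" and "finite V"
    and "\<And>x. x \<in> X \<Longrightarrow> \<exists>v\<in>V. dist x v < \<delta> \<and> dist (f x) (f v) \<le> \<delta>"
    and "E = {{v, w} |v w. v \<in> V \<and> w \<in> V \<and> v \<noteq> w \<and> dist v w \<le> 3 * \<delta>}"
    and "g = restrict f V"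
  shows "\<exists>S. decorated_correspondence
      ((5 * L + 1) * \<delta> + 3 * \<epsilon>) \<delta> ((5 * L + 1) * \<delta> + 3 * \<epsilon>)
      (reeb_space X f) (reeb_dist X f) (reeb_decoration X f)
      (graph_reeb_space V E g) (graph_reeb_dist V E g) (graph_reeb_decoration V E g) S"
proof -
  let ?N = "nearby X V f \<delta>"
  have edge_iff: "{u, u'} \<in> E \<longleftrightarrow> u \<in> V \<and> u' \<in> V \<and> u \<noteq> u' \<and> dist u u' \<le> 3 * \<delta>" for u u'
    unfolding assms(9) by (auto simp: doubleton_eq_iff dist_commute)
  have g: "g v = f v" if "v \<in> V" for v using that assms(10) by simp
  have cover: "\<exists>u. (z, u) \<in> ?N" if "z \<in> X" for z
    using assms(8)[OF that] that unfolding nearby_def by (auto intro: less_imp_le)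
  have self: "(v, v) \<in> ?N" if "v \<in> V" for v
    using that assms(5,6) by (auto simp: nearby_def)
  \<comment> \<open>A vertex is nearby to itself, so shadowing any path in \<open>X\<close> between two vertices shows
    that the graph is connected.\<close>
  have walks: "edge_paths V E v w \<noteq> {}" if vw: "v \<in> V" "w \<in> V" for v w
  proof -
    obtain \<gamma> where "\<gamma> \<in> paths_between X v w"
      using paths_between_nonempty[OF assms(3), of v w] vw assms(6) by blast
    then show ?thesis
      using edge_paths_shadowing_path[OF _ assms(5) _ cover self[OF vw(1)] self[OF vw(2)]]
        edge_iff by blast
  qed
  have corr: "correspondence X V ?N"
  proof -
    have "fst ` ?N = X" using cover by (force simp: nearby_def)
    moreover have "snd ` ?N = V" using self by (force simp: nearby_def)
    ultimately show ?thesis unfolding correspondence_def by (auto simp: nearby_def)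
  qed
  have L\<delta>: "0 \<le> L * \<delta>" using assms(1,5) by simp
  have "\<bar>reeb_radius X f x y - graph_reeb_radius V E g v w\<bar> \<le> (5 * L + 1) * \<delta> + 3 * \<epsilon>"
    if "(x, v) \<in> ?N" "(y, w) \<in> ?N" for x v y w
  proof -
    have "reeb_radius X f x y \<le> graph_reeb_radius V E g v w + (3 * L + 1) * \<delta> + 2 * \<epsilon>"
      by (rule reeb_radius_le_graph_reeb_radius[OF assms(3,4,1,5-7) walks _ g that])
        (simp_all add: edge_iff)
    moreover have "graph_reeb_radius V E g v w \<le> reeb_radius X f x y + (L + 1) * \<delta> + 2 * \<epsilon>"
      by (rule graph_reeb_radius_le_reeb_radius[OF assms(3,4,1,5-7) walks _ cover g that])
        (simp_all add: edge_iff)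
    ultimately show ?thesis using L\<delta> assms(2) by (simp add: algebra_simps abs_le_iff)
  qed
  then show ?thesis
    using decorated_correspondence_of_radius_distortion[OF assms(3,7) walks corr] nearbyD(3)
    by blast
qed

end
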